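(* Let $U=(u_{ij})_{i,j\in\mathbb{Z}}$ be a $\mathbb{Z}\times\mathbb{Z}$ matrix depending on $t_{\pm1},t_{\pm2},\ldots$ and satisfying $\partial U/\partial t_{\pm k}=\Lambda^{\pm k}U-U\Lambda^{\mp k}-U\mathcal{O}_{\pm k}U$ for $k=1,2,\ldots$, and let $$u_i(z)=\Bigl(z^i-\sum_{j=0}^\infty u_{ij}z^{-j-1}\Bigr)\rho(z),\qquad \bar u_i(z)=\Bigl(z^i+\sum_{j=0}^\infty u_{i,-j-1}z^j\Bigr)\rho(z),\qquad i\in\mathbb{Z}.$$ Put $\partial_x=\partial/\partial t_1+\partial/\partial t_{-1}$ and $$\Psi_{2\times2}(z)=\begin{pmatrix}u_0(z)&\bar u_0(z)\\ u_{-1}(z)&\bar u_{-1}(z)\end{pmatrix}.$$ Then for every $k\ge1$ $$\frac{\partial\Psi_{2\times2}(z)}{\partial t_{\pm k}}=\begin{pmatrix}A_{\pm k}&B_{\pm k}\\ C_{\pm k}&D_{\pm k}\end{pmatrix}\Psi_{2\times2}(z),$$ where $A_{\pm k},B_{\pm k},C_{\pm k},D_{\pm k}$ are differential operators in $\partial_x$ (with coefficients independent of $z$) of the form $$A_k=\partial_x^k+O(\partial_x^{k-1}),\quad B_k=-(1+u_{0,-1})\partial_x^{k-1}+O(\partial_x^{k-2}),\quad C_k=(1-u_{-1,0})\partial_x^{k-1}+O(\partial_x^{k-2}),\quad D_k=O(\partial_x^{k-2})$$ and $$A_{-k}=O(\partial_x^{k-2}),\quad B_{-k}=(1+u_{0,-1})\partial_x^{k-1}+O(\partial_x^{k-2}),\quad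 C_{-k}=-(1-u_{-1,0})\partial_x^{k-1}+O(\partial_x^{k-2}),\quad D_{-k}=\partial_x^k+O(\partial_x^{k-1}).$$
   Context: $E_{ij}$ is the $\mathbb{Z}\times\mathbb{Z}$ matrix unit; $\Lambda^k=\sum_{i\in\mathbb{Z}}E_{i,i+k}$ for $k\in\mathbb{Z}$; for $k\ge1$, $\mathcal{O}_k=\sum_{i=0}^{k-1}E_{i,k-i-1}$ and $\mathcal{O}_{-k}=-\sum_{l=1}^kE_{-l,l-k-1}$. $\rho(z)=\exp\bigl(\sum_{k=1}^\infty(t_kz^k+t_{-k}z^{-k})\bigr)$. The wave functions are formal Laurent series in $z$ times the factor $\rho(z)$, on which derivatives act by the Leibniz rule with $\partial\rho(z)/\partial t_{\pm k}=z^{\pm k}\rho(z)$. $O(\partial_x^n)$ denotes a differential operator in $\partial_x$ of order at most $n$ (zero if $n<0$), with coefficients functions of $t_{\pm1},t_{\pm 2},\ldots$. *)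

theory Defs
  imports
    "HOL-Analysis.Analysis"
    "HOL-Library.Function_Algebras"
    "HOL-Library.Groups_Big_Fun"
begin

section \<open>Functions of infinitely many times\<close>

text \<open>
  A point \<open>t\<close> assigns a value \<open>t k\<close> to every time variable \<open>t\<^sub>k\<close>, \<open>k \<noteq> 0\<close>. The component \<open>t 0\<close>
  is never differentiated; it is an idle parameter.
\<close>

type_synonym 'a tfun = "(int \<Rightarrow> 'a) \<Rightarrow> 'a"

definition pderiv_t :: "int \<Rightarrow> 'a::real_normed_field tfun \<Rightarrow> 'a tfun" where
  "pderiv_t k f t = deriv (\<lambda>s. f (t(k := s))) (t k)"

text \<open>
  The solutions need not be defined for all times. Only openness in each coordinate direction is
  needed for partial derivatives to make sense; this covers sets that are open in the product
  topology as well as sets that are open in finer topologies.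
\<close>

definition time_domain :: "(int \<Rightarrow> 'a::real_normed_field) set \<Rightarrow> bool" where
  "time_domain S \<longleftrightarrow> (\<forall>t\<in>S. \<forall>k. k \<noteq> 0 \<longrightarrow> (\<forall>\<^sub>F s in nhds (t k). t(k := s) \<in> S))"

text \<open>All iterated partial derivatives of \<open>f\<close> exist on \<open>S\<close>.\<close>

definition smooth_in :: "(int \<Rightarrow> 'a::real_normed_field) set \<Rightarrow> 'a tfun \<Rightarrow> bool" where
  "smooth_in S f \<longleftrightarrow>
     (\<forall>ks k t. 0 \<notin> set ks \<and> k \<noteq> 0 \<and> t \<in> S \<longrightarrow>
        (\<lambda>s. foldr pderiv_t ks f (t(k := s))) field_differentiable at (t k))"

section \<open>Matrices indexed by pairs of integers\<close>

type_synonym 'a zmat = "int \<Rightarrow> int \<Rightarrow> 'a"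

definition Eunit :: "int \<Rightarrow> int \<Rightarrow> 'a::zero_neq_one zmat" where
  "Eunit a b i j = (if i = a \<and> j = b then 1 else 0)"

text \<open>
  \<open>Sum_any\<close> sums over the support, which is finite in each entry of every product formed below.
\<close>

definition zmat_mul :: "'a::semiring_1 zmat \<Rightarrow> 'a zmat \<Rightarrow> 'a zmat" (infixl "\<otimes>\<^sub>Z" 70) where
  "(M \<otimes>\<^sub>Z N) i j = Sum_any (\<lambda>m. M i m * N m j)"

text \<open>The entries of \<open>\<Lambda>\<^sup>k = \<Sum>\<^sub>i E\<^sub>i\<^sub>,\<^sub>i\<^sub>+\<^sub>k\<close>, for \<open>k\<close> of either sign.\<close>

definition Lam :: "int \<Rightarrow> 'a::zero_neq_one zmat" where
  "Lam k i j = (if j = i + k then 1 else 0)"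

text \<open>\<open>Omat k\<close> and \<open>Omat (- k)\<close> for \<open>k \<ge> 1\<close> are the matrices \<open>O\<^sub>k\<close> and \<open>O\<^sub>-\<^sub>k\<close>.\<close>

definition Omat :: "int \<Rightarrow> 'a::ring_1 zmat" where
  "Omat k i j =
     (if 0 < k then \<Sum>l\<in>{0..k - 1}. Eunit l (k - l - 1) i j
      else - (\<Sum>l\<in>{1..- k}. Eunit (- l) (l - (- k) - 1) i j))"

definition flow_rhs :: "int \<Rightarrow> 'a::ring_1 zmat \<Rightarrow> 'a zmat" where
  "flow_rhs k U i j =
     (Lam k \<otimes>\<^sub>Z U) i j - (U \<otimes>\<^sub>Z Lam (- k)) i j - (U \<otimes>\<^sub>Z Omat k \<otimes>\<^sub>Z U) i j"

text \<open>\<open>\<partial>U/\<partial>t\<^sub>k = \<Lambda>\<^sup>k U - U \<Lambda>\<^sup>-\<^sup>k - U O\<^sub>k U\<close> on \<open>S\<close> for all \<open>k \<noteq> 0\<close>; existence of the derivatives is part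
  of the condition.\<close>

definition satisfies_flows ::
    "(int \<Rightarrow> 'a::real_normed_field) set \<Rightarrow> ((int \<Rightarrow> 'a) \<Rightarrow> 'a zmat) \<Rightarrow> bool" where
  "satisfies_flows S U \<longleftrightarrow>
     (\<forall>k t i j. k \<noteq> 0 \<and> t \<in> S \<longrightarrow>
        ((\<lambda>s. U (t(k := s)) i j) has_field_derivative flow_rhs k (U t) i j) (at (t k)))"

section \<open>Wave functions\<close>

text \<open>
  \<open>w\<close> stands for the formal expression \<open>(\<Sum>n. w n t * z ^ n) * \<rho>(z)\<close>, where \<open>n\<close> ranges over all
  integers. Since both kinds of Laurent series (in \<open>z\<close> and in \<open>1/z\<close>) occur, coefficients are
  indexed by \<open>int\<close> without a support condition.
\<close>

type_synonym 'a wave = "int \<Rightarrow> 'a tfun"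

text \<open>The Leibniz rule with \<open>\<partial>\<rho>/\<partial>t\<^sub>k = z\<^sup>k \<rho>\<close>, for \<open>k \<noteq> 0\<close>.\<close>

definition wderiv :: "int \<Rightarrow> 'a::real_normed_field wave \<Rightarrow> 'a wave" where
  "wderiv k w n t = pderiv_t k (w n) t + w (n - k) t"

definition wderiv_x :: "'a::real_normed_field wave \<Rightarrow> 'a wave" where
  "wderiv_x w n t = wderiv 1 w n t + wderiv (- 1) w n t"

text \<open>
  The coefficient of \<open>z\<^sup>n\<close> in \<open>z\<^sup>i - \<Sum>\<^sub>j u\<^sub>i\<^sub>j z\<^sup>-\<^sup>j\<^sup>-\<^sup>1\<close> and in \<open>z\<^sup>i + \<Sum>\<^sub>j u\<^sub>i\<^sub>,\<^sub>-\<^sub>j\<^sub>-\<^sub>1 z\<^sup>j\<close>, where \<open>j \<ge> 0\<close>.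
\<close>

definition wave_u :: "((int \<Rightarrow> 'a::real_normed_field) \<Rightarrow> 'a zmat) \<Rightarrow> int \<Rightarrow> 'a wave" where
  "wave_u U i n t = (if n = i then 1 else 0) - (if n < 0 then U t i (- n - 1) else 0)"

definition wave_ubar :: "((int \<Rightarrow> 'a::real_normed_field) \<Rightarrow> 'a zmat) \<Rightarrow> int \<Rightarrow> 'a wave" where
  "wave_ubar U i n t = (if n = i then 1 else 0) + (if n \<ge> 0 then U t i (- n - 1) else 0)"

definition Psi :: "((int \<Rightarrow> 'a::real_normed_field) \<Rightarrow> 'a zmat) \<Rightarrow> 'a wave ^ 2 ^ 2" where
  "Psi U = vector [vector [wave_u U 0,     wave_ubar U 0],
                   vector [wave_u U (- 1), wave_ubar U (- 1)]]"

section \<open>Differential operators in \<open>\<partial>\<^sub>x\<close>\<close>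

text \<open>
  The operator \<open>\<Sum>\<^sub>j a\<^sub>j(t) \<partial>\<^sub>x\<^sup>j\<close> is represented by the polynomial with coefficients \<open>a\<^sub>j\<close>. Only the
  additive structure of polynomials is meaningful: their product is not composition.
\<close>

type_synonym 'a dop = "'a tfun poly"

definition dop_apply :: "'a::real_normed_field dop \<Rightarrow> 'a wave \<Rightarrow> 'a wave" where
  "dop_apply P w n t = (\<Sum>j\<le>degree P. coeff P j t * (wderiv_x ^^ j) w n t)"

definition dop_mat_apply ::
    "'a::real_normed_field dop ^ 2 ^ 2 \<Rightarrow> 'a wave ^ 2 ^ 2 \<Rightarrow> 'a wave ^ 2 ^ 2" where
  "dop_mat_apply L W = (\<chi> i j. (\<lambda>n t. \<Sum>l\<in>UNIV. dop_apply (L $ i $ l) (W $ l $ j) n t))"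

text \<open>\<open>O(\<partial>\<^sub>x\<^sup>m)\<close>, which contains only \<open>0\<close> if \<open>m < 0\<close>.\<close>

definition dop_O :: "(int \<Rightarrow> 'a::real_normed_field) set \<Rightarrow> int \<Rightarrow> 'a dop set" where
  "dop_O S m = {P. (\<forall>j. smooth_in S (coeff P j)) \<and> (\<forall>j. int j > m \<longrightarrow> coeff P j = 0)}"

definition evolves_by ::
    "(int \<Rightarrow> 'a::real_normed_field) set \<Rightarrow> int \<Rightarrow> 'a wave ^ 2 ^ 2 \<Rightarrow> 'a dop ^ 2 ^ 2 \<Rightarrow> bool" where
  "evolves_by S k W L \<longleftrightarrow>
     (\<forall>i j n. \<forall>t\<in>S. wderiv k (W $ i $ j) n t = (dop_mat_apply L W $ i $ j) n t)"

end

theory Submission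
  imports Defs
begin

text \<open>
  For \<open>k \<noteq> 0\<close>, both \<open>w\<^sub>i = u\<^sub>i(z)\<close> and \<open>w\<^sub>i = ubar\<^sub>i(z)\<close> satisfy
  \<open>\<partial>w\<^sub>i/\<partial>t\<^sub>k = w\<^sub>i\<^sub>+\<^sub>k - sgn k * (\<Sum>m. u\<^sub>i\<^sub>,\<^sub>k\<^sub>-\<^sub>1\<^sub>-\<^sub>m w\<^sub>m)\<close>, where \<open>m\<close> ranges over \<open>0, \<dots>, k - 1\<close> if
  \<open>k > 0\<close> and over \<open>k, \<dots>, -1\<close> if \<open>k < 0\<close>. Adding the cases of \<open>t\<^sub>1\<close> and \<open>t\<^sub>-\<^sub>1\<close> gives
  \<open>\<partial>\<^sub>x w\<^sub>i = w\<^sub>i\<^sub>+\<^sub>1 + w\<^sub>i\<^sub>-\<^sub>1 - u\<^sub>i\<^sub>,\<^sub>0 w\<^sub>0 + u\<^sub>i\<^sub>,\<^sub>-\<^sub>1 w\<^sub>-\<^sub>1\<close>, a three-term recursion that expresses every \<open>w\<^sub>i\<close>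
  through \<open>w\<^sub>0\<close> and \<open>w\<^sub>-\<^sub>1\<close> by differential operators whose leading terms can be read off.
  Substituting these into the first equation for \<open>i = 0, -1\<close> gives the assertion.
\<close>

section \<open>The flow equations entry by entry\<close>

lemma Sum_any_supported:
  fixes f :: "'b \<Rightarrow> 'a::comm_monoid_add"
  assumes "finite A" "\<And>x. x \<notin> A \<Longrightarrow> f x = 0"
  shows "Sum_any f = sum f A"
  using assms by (intro Sum_any.expand_superset) auto

text \<open>The columns, and equally the rows, in which \<open>Omat k\<close> has a nonzero
  entry.\<close>

definition flow_range :: "int \<Rightarrow> int set" where
  "flow_range k = (if 0 < k then {0..k - 1} else {k..- 1})"

lemma finite_flow_range [simp]: "finite (flow_range k)"
  by (simp add: flow_range_def)

text \<open>For either sign of \<open>k\<close> the nonzero entries lie on the antidiagonal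
  \<open>i + j = k - 1\<close> and equal \<open>sgn k\<close>. This uniform form lets one
  computation serve both directions of the flow.\<close>

lemma Omat_eq:
  assumes "k \<noteq> 0"
  shows "Omat k i j = (if j \<in> flow_range k \<and> i = k - 1 - j then of_int (sgn k) else (0::'a::ring_1))"
proof (cases "0 < k")
  case True
  have "Omat k i j = (\<Sum>l\<in>{0..k - 1}. if l = i then if j = k - l - 1 then 1 else 0 else (0::'a))"
    unfolding Omat_def if_P[OF True] by (rule sum.cong) (auto simp: Eunit_def)
  also have "\<dots> = (if i \<in> {0..k - 1} then if j = k - i - 1 then 1 else 0 else 0)"
    by (rule sum.delta) simp
  finally show ?thesis
    using True by (auto simp: flow_range_def)
next
  case False
  have "Omat k i j = - (\<Sum>l\<in>{1..- k}. if l = - i then if j = l + k - 1 then 1 else 0 else (0::'a))"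
    unfolding Omat_def if_not_P[OF False]
    by (intro arg_cong[of _ _ uminus] sum.cong) (auto simp: Eunit_def)
  also have "\<dots> = - (if - i \<in> {1..- k} then if j = - i + k - 1 then 1 else 0 else 0)"
    by (subst sum.delta) simp_all
  finally show ?thesis
    using False assms by (auto simp: flow_range_def)
qed

lemma flow_rhs_eq:
  fixes U :: "'a::comm_ring_1 zmat"
  assumes "k \<noteq> 0"
  shows "flow_rhs k U i j = U (i + k) j - U i (j + k)
    - of_int (sgn k) * (\<Sum>m\<in>flow_range k. U i (k - 1 - m) * U m j)"
proof -
  have 1: "(Lam k \<otimes>\<^sub>Z U) i j = U (i + k) j"
    unfolding zmat_mul_def by (subst Sum_any_supported[of "{i + k}"]) (auto simp: Lam_def)
  have 2: "(U \<otimes>\<^sub>Z Lam (- k)) i j = U i (j + k)"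
    unfolding zmat_mul_def by (subst Sum_any_supported[of "{j + k}"]) (auto simp: Lam_def)
  have 3: "(U \<otimes>\<^sub>Z Omat k) i m = (if m \<in> flow_range k then U i (k - 1 - m) * of_int (sgn k) else 0)" for m
    unfolding zmat_mul_def
    by (subst Sum_any_supported[of "{k - 1 - m}"]) (use assms in \<open>auto simp: Omat_eq\<close>)
  have "(U \<otimes>\<^sub>Z Omat k \<otimes>\<^sub>Z U) i j
      = (\<Sum>m\<in>flow_range k. U i (k - 1 - m) * of_int (sgn k) * U m j)"
    unfolding zmat_mul_def[of "U \<otimes>\<^sub>Z Omat k"]
    by (subst Sum_any_supported[of "flow_range k"]) (auto simp: 3)
  then show ?thesis
    by (simp add: flow_rhs_def 1 2 sum_distrib_left mult_ac)
qed

section \<open>Operators in \<open>\<partial>\<^sub>x\<close>\<close>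

definition pderiv_x :: "'a::real_normed_field tfun \<Rightarrow> 'a tfun" where
  "pderiv_x f t = pderiv_t 1 f t + pderiv_t (- 1) f t"

lemma pderiv_x_const [simp]: "pderiv_x (\<lambda>_. c) = 0"
  by (simp add: pderiv_x_def pderiv_t_def fun_eq_iff)

lemma pderiv_x_0 [simp]: "pderiv_x 0 = 0"
  by (simp add: zero_fun_def)

lemma wderiv_x_eq: "wderiv_x w n t = pderiv_x (w n) t + w (n - 1) t + w (n + 1) t"
  by (simp add: wderiv_x_def wderiv_def pderiv_x_def)

text \<open>The composition of \<open>\<partial>\<^sub>x\<close> with \<open>P\<close>, by the
  Leibniz rule: each \<open>a \<partial>\<^sub>x^j\<close> becomes
  \<open>a \<partial>\<^sub>x^(j + 1)\<close> plus the derivative of \<open>a\<close> times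
  \<open>\<partial>\<^sub>x^j\<close>.\<close>

definition dop_dx :: "'a::real_normed_field dop \<Rightarrow> 'a dop" where
  "dop_dx P = pCons 0 P + map_poly pderiv_x P"

lemma coeff_dop_dx:
  "coeff (dop_dx P) j = (if j = 0 then 0 else coeff P (j - 1)) + pderiv_x (coeff P j)"
  by (simp add: dop_dx_def coeff_map_poly coeff_pCons split: nat.split)

lemma dop_dx_0 [simp]: "dop_dx 0 = 0"
  by (simp add: dop_dx_def)

lemma dop_dx_pCons: "dop_dx (pCons a P) = pCons (pderiv_x a) ([:a:] + dop_dx P)"
  by (rule poly_eqI) (auto simp: coeff_dop_dx coeff_pCons split: nat.split)

lemma dop_apply_bound:
  assumes "degree P \<le> N"
  shows "dop_apply P w n t = (\<Sum>j\<le>N. coeff P j t * (wderiv_x ^^ j) w n t)"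
  unfolding dop_apply_def
  by (rule sum.mono_neutral_left) (use assms in \<open>auto simp: coeff_eq_0\<close>)

lemma dop_apply_0 [simp]: "dop_apply 0 w n t = 0"
  by (simp add: dop_apply_def)

lemma dop_apply_const [simp]: "dop_apply [:a:] w n t = a t * w n t"
  by (simp add: dop_apply_def)

lemma dop_apply_add: "dop_apply (P + Q) w n t = dop_apply P w n t + dop_apply Q w n t"
proof -
  define N where "N = max (degree P) (degree Q)"
  have "degree P \<le> N" "degree Q \<le> N" "degree (P + Q) \<le> N"
    by (auto simp: N_def degree_add_le)
  then show ?thesis
    by (simp add: dop_apply_bound[of _ N] sum.distrib[symmetric] algebra_simps)
qed

lemma dop_apply_smult: "dop_apply (smult a P) w n t = a t * dop_apply P w n t"
  by (simp add: dop_apply_bound[OF degree_smult_le] sum_distrib_left mult_ac)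
    (simp add: dop_apply_def sum_distrib_left mult_ac)

lemma dop_apply_minus: "dop_apply (- P) w n t = - dop_apply P w n t"
  by (simp add: dop_apply_def sum_negf)

lemma dop_apply_diff: "dop_apply (P - Q) w n t = dop_apply P w n t - dop_apply Q w n t"
  using dop_apply_add[of P "- Q"] by (simp add: dop_apply_minus)

lemma dop_apply_sum: "dop_apply (\<Sum>x\<in>X. P x) w n t = (\<Sum>x\<in>X. dop_apply (P x) w n t)"
  by (induction X rule: infinite_finite_induct) (simp_all add: dop_apply_add)

text \<open>Reads \<open>pCons a P\<close> as \<open>a + P \<partial>\<^sub>x\<close>, with the
  split-off \<open>\<partial>\<^sub>x\<close> acting first. Inductions on \<open>P\<close> must
  therefore keep \<open>w\<close> arbitrary.\<close>

lemma dop_apply_pCons: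
  "dop_apply (pCons a P) w n t = a t * w n t + dop_apply P (wderiv_x w) n t"
proof -
  have "dop_apply (pCons a P) w n t
      = (\<Sum>j\<le>Suc (degree P). coeff (pCons a P) j t * (wderiv_x ^^ j) w n t)"
    by (rule dop_apply_bound) (rule degree_pCons_le)
  also have "\<dots> = a t * w n t + (\<Sum>j\<le>degree P. coeff P j t * (wderiv_x ^^ j) (wderiv_x w) n t)"
    by (simp only: sum.atMost_Suc_shift funpow_Suc_right) simp
  finally show ?thesis
    by (simp add: dop_apply_def)
qed

text \<open>The three-term recursion for the waves, transferred to the operator multiplying one of
  the two basic waves; \<open>c\<close> collects the inhomogeneous terms.\<close>

fun dop_rec :: "(nat \<Rightarrow> 'a::real_normed_field tfun) \<Rightarrow> 'a dop \<Rightarrow> 'a dop \<Rightarrow> nat \<Rightarrow> 'a dop" where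
  "dop_rec c P Q 0 = P"
| "dop_rec c P Q (Suc 0) = Q"
| "dop_rec c P Q (Suc (Suc n)) = dop_dx (dop_rec c P Q (Suc n)) - dop_rec c P Q n + [:c n:]"

section \<open>Polynomials in the entries of \<open>U\<close> and their derivatives\<close>

locale flow_solution =
  fixes S :: "(int \<Rightarrow> 'a::real_normed_field) set" and U :: "(int \<Rightarrow> 'a) \<Rightarrow> 'a zmat"
  assumes domain: "time_domain S" and flows: "satisfies_flows S U"
begin

text \<open>The functions that agree on \<open>S\<close> with a polynomial in the \<open>u\<^sub>i\<^sub>j\<close>. The flow equations make them
  closed under all \<open>\<partial>/\<partial>t\<^sub>k\<close>, hence smooth.\<close>

inductive_set upoly :: "'a tfun set" where
  const: "(\<lambda>_. c) \<in> upoly"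
| entry: "(\<lambda>t. U t i j) \<in> upoly"
| add: "f \<in> upoly \<Longrightarrow> g \<in> upoly \<Longrightarrow> f + g \<in> upoly"
| mult: "f \<in> upoly \<Longrightarrow> g \<in> upoly \<Longrightarrow> f * g \<in> upoly"
| eq_on: "f \<in> upoly \<Longrightarrow> (\<And>t. t \<in> S \<Longrightarrow> g t = f t) \<Longrightarrow> g \<in> upoly"

lemma upoly_0 [simp]: "0 \<in> upoly" and upoly_1 [simp]: "1 \<in> upoly"
  using const[of 0] const[of 1] by (simp_all add: zero_fun_def one_fun_def)

lemma upoly_uminus: "f \<in> upoly \<Longrightarrow> - f \<in> upoly"
  using mult[OF const[of "- 1"], of f] by (simp add: fun_eq_iff eq_on)

lemma upoly_diff: "f \<in> upoly \<Longrightarrow> g \<in> upoly \<Longrightarrow> f - g \<in> upoly"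
  using add[OF _ upoly_uminus, of f g] by simp

lemma upoly_sum: "(\<And>x. x \<in> X \<Longrightarrow> f x \<in> upoly) \<Longrightarrow> (\<lambda>t. \<Sum>x\<in>X. f x t) \<in> upoly"
proof (induction X rule: infinite_finite_induct)
  case (insert x X)
  then have "f x + (\<lambda>t. \<Sum>x\<in>X. f x t) \<in> upoly"
    by (intro add) auto
  then show ?case
    by (rule eq_on) (use insert in auto)
qed (simp_all add: const)

lemma upoly_flow_rhs:
  assumes "k \<noteq> 0"
  shows "(\<lambda>t. flow_rhs k (U t) i j) \<in> upoly"
proof -
  have "(\<lambda>t. U t (i + k) j) - (\<lambda>t. U t i (j + k)) - (\<lambda>_. of_int (sgn k)) *
      (\<lambda>t. \<Sum>m\<in>flow_range k. ((\<lambda>t. U t i (k - 1 - m)) * (\<lambda>t. U t m j)) t) \<in> upoly"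
    by (intro upoly_diff mult upoly_sum entry const)
  then show ?thesis
    by (rule eq_on) (simp add: flow_rhs_eq[OF assms])
qed

lemma eventually_in_domain:
  "t \<in> S \<Longrightarrow> k \<noteq> 0 \<Longrightarrow> \<forall>\<^sub>F s in nhds (t k). t(k := s) \<in> S"
  using domain by (simp add: time_domain_def)

text \<open>The flow equations settle the generators \<open>entry\<close>, the sum and product rules
  the compound functions. For \<open>eq_on\<close>, the domain contains a neighbourhood of
  \<open>t\<close> in direction \<open>k\<close>, so functions agreeing on \<open>S\<close> have the
  same derivative there.\<close>

lemma upoly_has_derivative:
  assumes "f \<in> upoly" "k \<noteq> 0"
  shows "\<exists>g\<in>upoly. \<forall>t\<in>S. ((\<lambda>s. f (t(k := s))) has_field_derivative g t) (at (t k))"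
  using assms(1)
proof induction
  case (const c)
  show ?case
    by (rule bexI[of _ 0]) auto
next
  case (entry i j)
  show ?case
    by (rule bexI[of _ "\<lambda>t. flow_rhs k (U t) i j"])
      (use flows assms(2) in \<open>auto simp: satisfies_flows_def upoly_flow_rhs simp del: fun_upd_apply\<close>)
next
  case (add f g)
  then obtain f' g' where "f' \<in> upoly" "g' \<in> upoly"
    and "\<forall>t\<in>S. ((\<lambda>s. f (t(k := s))) has_field_derivative f' t) (at (t k))"
    and "\<forall>t\<in>S. ((\<lambda>s. g (t(k := s))) has_field_derivative g' t) (at (t k))"
    by blast
  then show ?case
    by (intro bexI[of _ "f' + g'"]) (auto simp del: fun_upd_apply intro!: derivative_eq_intros upoly.add)
next
  case (mult f g)
  then obtain f' g' where "f' \<in> upoly" "g' \<in> upoly"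
    and "\<forall>t\<in>S. ((\<lambda>s. f (t(k := s))) has_field_derivative f' t) (at (t k))"
    and "\<forall>t\<in>S. ((\<lambda>s. g (t(k := s))) has_field_derivative g' t) (at (t k))"
    by blast
  then show ?case
    using mult.hyps by (intro bexI[of _ "f' * g + g' * f"])
      (auto simp del: fun_upd_apply intro!: derivative_eq_intros upoly.add upoly.mult)
next
  case (eq_on f g)
  then obtain f' where f': "f' \<in> upoly"
    "\<forall>t\<in>S. ((\<lambda>s. f (t(k := s))) has_field_derivative f' t) (at (t k))"
    by blast
  have "((\<lambda>s. g (t(k := s))) has_field_derivative f' t) (at (t k))" if "t \<in> S" for t
  proof -
    have "\<forall>\<^sub>F s in nhds (t k). g (t(k := s)) = f (t(k := s))"
      using eventually_in_domain[OF that assms(2)] eq_on.hyps(2) by (rule eventually_mono)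
    then show ?thesis
      using f'(2) that by (subst DERIV_cong_ev) auto
  qed
  then show ?case
    using f'(1) by blast
qed

lemma upoly_derivative:
  assumes "f \<in> upoly" "k \<noteq> 0" "t \<in> S"
  shows "((\<lambda>s. f (t(k := s))) has_field_derivative pderiv_t k f t) (at (t k))"
  using upoly_has_derivative[OF assms(1,2)] assms(3)
  by (metis DERIV_imp_deriv pderiv_t_def)

text \<open>The values of \<open>pderiv_t k f\<close> off \<open>S\<close> are uncontrolled; closure
  under \<open>eq_on\<close> absorbs this.\<close>

lemma upoly_pderiv_t:
  assumes "f \<in> upoly" "k \<noteq> 0"
  shows "pderiv_t k f \<in> upoly"
  using upoly_has_derivative[OF assms] upoly_derivative[OF assms]
  by (metis DERIV_unique eq_on)

lemma upoly_smooth: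
  assumes "f \<in> upoly"
  shows "smooth_in S f"
proof -
  have "0 \<notin> set ks \<Longrightarrow> foldr pderiv_t ks f \<in> upoly" for ks
    by (induction ks) (auto simp: assms upoly_pderiv_t)
  then show ?thesis
    using upoly_derivative unfolding smooth_in_def field_differentiable_def by blast
qed

lemma pderiv_t_eq_on:
  assumes "\<And>t. t \<in> S \<Longrightarrow> f t = g t" "k \<noteq> 0" "t \<in> S"
  shows "pderiv_t k f t = pderiv_t k g t"
  unfolding pderiv_t_def
  by (rule deriv_cong_ev)
    (use eventually_in_domain[OF assms(3,2)] assms(1) in \<open>auto elim: eventually_mono\<close>)

lemma upoly_pderiv_x: "f \<in> upoly \<Longrightarrow> pderiv_x f \<in> upoly"
  by (rule eq_on[OF add[OF upoly_pderiv_t[of f 1] upoly_pderiv_t[of f "- 1"]]])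
    (auto simp: pderiv_x_def)

lemma pderiv_t_add:
  assumes "f \<in> upoly" "g \<in> upoly" "k \<noteq> 0" "t \<in> S"
  shows "pderiv_t k (f + g) t = pderiv_t k f t + pderiv_t k g t"
  using DERIV_add[OF upoly_derivative[of f k t] upoly_derivative[of g k t]] assms
  by (auto simp: pderiv_t_def intro!: DERIV_imp_deriv)

lemma pderiv_t_mult:
  assumes "f \<in> upoly" "g \<in> upoly" "k \<noteq> 0" "t \<in> S"
  shows "pderiv_t k (f * g) t = pderiv_t k f t * g t + f t * pderiv_t k g t"
  using DERIV_mult[OF upoly_derivative[of f k t] upoly_derivative[of g k t]] assms
  by (auto simp: pderiv_t_def mult_ac add_ac intro!: DERIV_imp_deriv)

section \<open>Operators acting on waves\<close>

lemma wderiv_x_eq_on: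
  assumes "\<And>n t. t \<in> S \<Longrightarrow> v n t = w n t" "t \<in> S"
  shows "wderiv_x v n t = wderiv_x w n t"
  using assms pderiv_t_eq_on[of "v n" "w n"] by (simp add: wderiv_x_eq pderiv_x_def)

lemma upoly_wderiv_x: "(\<And>n. w n \<in> upoly) \<Longrightarrow> wderiv_x w n \<in> upoly"
  by (rule eq_on[OF add[OF add[OF upoly_pderiv_x[of "w n"]]], of "w (n - 1)" "w (n + 1)"])
    (auto simp: wderiv_x_eq)

lemma wderiv_x_add:
  assumes "\<And>n. v n \<in> upoly" "\<And>n. w n \<in> upoly" "t \<in> S"
  shows "wderiv_x (\<lambda>n. v n + w n) n t = wderiv_x v n t + wderiv_x w n t"
  using assms by (simp add: wderiv_x_eq pderiv_x_def pderiv_t_add)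

lemma wderiv_x_mult:
  assumes "a \<in> upoly" "\<And>n. w n \<in> upoly" "t \<in> S"
  shows "wderiv_x (\<lambda>n. a * w n) n t = pderiv_x a t * w n t + a t * wderiv_x w n t"
  using assms by (simp add: wderiv_x_eq pderiv_x_def pderiv_t_mult algebra_simps)

lemma upoly_dop_apply:
  assumes "\<And>j. coeff P j \<in> upoly" "\<And>n. w n \<in> upoly"
  shows "dop_apply P w n \<in> upoly"
  using assms
proof (induction P arbitrary: w n)
  case 0
  then show ?case by (simp add: eq_on[OF upoly_0])
next
  case (pCons a P)
  have a: "a \<in> upoly" and P: "coeff P j \<in> upoly" for j
    using pCons.prems(1)[of 0] pCons.prems(1)[of "Suc j"] by auto
  show ?case
    by (rule eq_on[OF add[OF mult[OF a, of "w n"] pCons.IH[OF P, of "wderiv_x w" n]]])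
      (auto simp: pCons.prems(2) upoly_wderiv_x dop_apply_pCons)
qed

text \<open>Justifies \<open>dop_dx\<close> as composition. Membership in \<open>upoly\<close>
  supplies the differentiability behind the sum and product rules; the induction hypothesis is
  applied to \<open>wderiv_x w\<close>.\<close>

lemma wderiv_x_dop_apply:
  assumes "\<And>j. coeff P j \<in> upoly" "\<And>n. w n \<in> upoly" "t \<in> S"
  shows "wderiv_x (dop_apply P w) n t = dop_apply (dop_dx P) w n t"
  using assms(1,2)
proof (induction P arbitrary: w)
  case 0
  have "dop_apply 0 w = (\<lambda>n. 0)"
    by (simp add: fun_eq_iff)
  then show ?case
    by (simp add: wderiv_x_eq)
next
  case (pCons a P)
  have a: "a \<in> upoly" and P: "coeff P j \<in> upoly" for j
    using pCons.prems(1)[of 0] pCons.prems(1)[of "Suc j"] by auto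
  have w: "wderiv_x w n \<in> upoly" for n
    using pCons.prems(2) by (rule upoly_wderiv_x)
  have "dop_apply (pCons a P) w = (\<lambda>n. a * w n + dop_apply P (wderiv_x w) n)"
    by (simp add: fun_eq_iff dop_apply_pCons)
  then have "wderiv_x (dop_apply (pCons a P) w) n t
      = wderiv_x (\<lambda>n. a * w n + dop_apply P (wderiv_x w) n) n t"
    by (simp only:)
  also have "\<dots> = wderiv_x (\<lambda>n. a * w n) n t + wderiv_x (dop_apply P (wderiv_x w)) n t"
    by (rule wderiv_x_add) (simp_all add: mult a P w pCons.prems(2) upoly_dop_apply assms(3))
  also have "\<dots> = dop_apply (dop_dx (pCons a P)) w n t"
    by (simp add: wderiv_x_mult a pCons.prems(2) assms(3) pCons.IH[OF P w] dop_dx_pCons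
        dop_apply_pCons dop_apply_add)
  finally show ?case .
qed

section \<open>Time derivatives of the waves\<close>

text \<open>The case \<open>a = -1\<close> is \<open>u\<^sub>i\<close> and the case \<open>a = 0\<close> is \<open>ubar\<^sub>i\<close>.\<close>

definition wave :: "'a \<Rightarrow> int \<Rightarrow> 'a wave" where
  "wave a i n t = (if n = i then 1 else 0) + (a + (if 0 \<le> n then 1 else 0)) * U t i (- n - 1)"

lemma wave_u_eq: "wave_u U i = wave (- 1) i" and wave_ubar_eq: "wave_ubar U i = wave 0 i"
  by (simp_all add: wave_u_def wave_ubar_def wave_def fun_eq_iff)

lemma upoly_wave: "wave a i n \<in> upoly"
  by (rule eq_on[OF add[OF const mult[OF const entry]]]) (simp add: wave_def)

lemma pderiv_t_wave:
  assumes "k \<noteq> 0" "t \<in> S"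
  shows "pderiv_t k (wave a i n) t
    = (a + (if 0 \<le> n then 1 else 0)) * flow_rhs k (U t) i (- n - 1)"
  unfolding pderiv_t_def wave_def
  by (rule DERIV_imp_deriv)
    (use flows assms in \<open>auto simp: satisfies_flows_def simp del: fun_upd_apply intro!: derivative_eq_intros\<close>)

text \<open>At \<open>z^n\<close>, the term \<open>U \<Lambda>^(-k)\<close> of the flow and the
  shift caused by the exponential factor both produce \<open>U t i (k - 1 - n)\<close>, with weights
  \<open>- b n\<close> and \<open>b (n - k)\<close>. What survives their cancellation supplies the
  pure powers \<open>z^m\<close> of the waves in the sum; \<open>U O_k U\<close> supplies the rest
  of those waves.\<close>

lemma wderiv_wave:
  assumes "k \<noteq> 0" "t \<in> S"
  shows "wderiv k (wave a i) n t = wave a (i + k) n t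
    - of_int (sgn k) * (\<Sum>m\<in>flow_range k. U t i (k - 1 - m) * wave a m n t)"
proof -
  define b where "b n = a + (if 0 \<le> n then 1 else 0)" for n :: int
  define T where "T = (\<Sum>m\<in>flow_range k. U t i (k - 1 - m) * U t m (- n - 1))"
  have "(\<Sum>m\<in>flow_range k. U t i (k - 1 - m) * wave a m n t)
      = (\<Sum>m\<in>flow_range k. if m = n then U t i (k - 1 - m) else 0) + b n * T"
    unfolding T_def sum_distrib_left sum.distrib[symmetric]
    by (rule sum.cong) (auto simp: wave_def b_def algebra_simps)
  also have "\<dots> = (if n \<in> flow_range k then U t i (k - 1 - n) else 0) + b n * T"
    by (subst sum.delta) simp_all
  finally have sum: "(\<Sum>m\<in>flow_range k. U t i (k - 1 - m) * wave a m n t)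
      = (if n \<in> flow_range k then U t i (k - 1 - n) else 0) + b n * T" .
  \<comment> \<open>\<open>n\<close> and \<open>n - k\<close> lie on different sides of the jump at
    0 exactly for \<open>n\<close> in \<open>flow_range k\<close>. The constant \<open>a\<close>
    cancels, so both kinds of waves obey the same equation.\<close>
  have jump: "b n - b (n - k) = of_int (sgn k) * (if n \<in> flow_range k then 1 else 0)"
    using assms(1) by (auto simp: b_def flow_range_def)
  have "wderiv k (wave a i) n t
      = b n * (U t (i + k) (- n - 1) - U t i (k - 1 - n) - of_int (sgn k) * T)
        + ((if n = i + k then 1 else 0) + b (n - k) * U t i (k - 1 - n))"
    using assms
    by (auto simp: wderiv_def pderiv_t_wave flow_rhs_eq wave_def b_def T_def algebra_simps)
  also have "\<dots> = (if n = i + k then 1 else 0) + b n * U t (i + k) (- n - 1)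
      - (b n - b (n - k)) * U t i (k - 1 - n) - of_int (sgn k) * (b n * T)"
    by (simp add: algebra_simps)
  also have "\<dots> = wave a (i + k) n t
      - of_int (sgn k) * ((if n \<in> flow_range k then U t i (k - 1 - n) else 0) + b n * T)"
    unfolding jump by (simp add: wave_def b_def algebra_simps)
  finally show ?thesis
    by (simp only: sum)
qed

lemma wderiv_x_wave:
  assumes "t \<in> S"
  shows "wderiv_x (wave a i) n t = wave a (i + 1) n t + wave a (i - 1) n t
    - U t i 0 * wave a 0 n t + U t i (- 1) * wave a (- 1) n t"
proof -
  have "flow_range 1 = {0}" "flow_range (- 1) = {- 1}"
    by (auto simp: flow_range_def)
  then show ?thesis
    using assms by (simp add: wderiv_x_def wderiv_wave)
qed

section \<open>All waves in terms of two\<close>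

lemma coeff_dop_rec:
  assumes "\<And>j. coeff P j \<in> upoly" "\<And>j. coeff Q j \<in> upoly" "\<And>n. c n \<in> upoly"
  shows "coeff (dop_rec c P Q n) j \<in> upoly"
proof (induction n arbitrary: j rule: induct_nat_012)
  case (ge2 n)
  have "coeff (dop_dx R) j \<in> upoly" if "\<And>j. coeff R j \<in> upoly" for R
    unfolding coeff_dop_dx using that by (auto intro: add upoly_pderiv_x)
  moreover have "coeff [:c n:] j \<in> upoly"
    by (cases j) (simp_all add: assms(3))
  ultimately show ?case
    unfolding dop_rec.simps coeff_add coeff_diff using ge2.IH by (intro add upoly_diff) blast+
qed (simp_all add: assms)

text \<open>The inhomogeneity splits into multiples of \<open>w\<close> and of \<open>w'\<close>, so
  the recursion separates into one for each operator, \<open>\<partial>\<^sub>x\<close> passing to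
  the operators as \<open>dop_dx\<close>.\<close>

lemma dop_rec_apply:
  assumes coeffs: "\<And>j. coeff P j \<in> upoly" "\<And>j. coeff P' j \<in> upoly" "\<And>n. c n \<in> upoly"
    "\<And>j. coeff Q j \<in> upoly" "\<And>j. coeff Q' j \<in> upoly" "\<And>n. d n \<in> upoly"
    and w: "\<And>N. w N \<in> upoly" "\<And>N. w' N \<in> upoly"
    and v0: "\<And>N t. t \<in> S \<Longrightarrow> v 0 N t = dop_apply P w N t + dop_apply Q w' N t"
    and v1: "\<And>N t. t \<in> S \<Longrightarrow> v (Suc 0) N t = dop_apply P' w N t + dop_apply Q' w' N t"
    and step: "\<And>n N t. t \<in> S \<Longrightarrow> v (Suc (Suc n)) N t
      = wderiv_x (v (Suc n)) N t - v n N t + c n t * w N t + d n t * w' N t"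
    and "t \<in> S"
  shows "v n N t = dop_apply (dop_rec c P P' n) w N t + dop_apply (dop_rec d Q Q' n) w' N t"
  using \<open>t \<in> S\<close>
proof (induction n arbitrary: N t rule: induct_nat_012)
  case (ge2 n)
  let ?A = "dop_rec c P P'" and ?B = "dop_rec d Q Q'"
  have A: "coeff (?A m) j \<in> upoly" and B: "coeff (?B m) j \<in> upoly" for m j
    using coeffs by (auto intro!: coeff_dop_rec)
  have "wderiv_x (v (Suc n)) N t
      = wderiv_x (\<lambda>N. dop_apply (?A (Suc n)) w N + dop_apply (?B (Suc n)) w' N) N t"
    by (rule wderiv_x_eq_on) (use ge2 in auto)
  also have "\<dots> = wderiv_x (dop_apply (?A (Suc n)) w) N t + wderiv_x (dop_apply (?B (Suc n)) w') N t"
    by (rule wderiv_x_add) (simp_all add: upoly_dop_apply A B w ge2.prems)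
  also have "\<dots> = dop_apply (dop_dx (?A (Suc n))) w N t + dop_apply (dop_dx (?B (Suc n))) w' N t"
    by (simp add: wderiv_x_dop_apply A B w ge2.prems)
  finally show ?case
    by (simp add: step ge2 dop_apply_add dop_apply_diff)
qed (simp_all add: v0 v1)

text \<open>\<open>w\<^sub>i = opA i w\<^sub>0 + opB i w\<^sub>-\<^sub>1\<close> both for \<open>w = u\<close> and for \<open>w = ubar\<close>. The recursions come from solving
  the equation of \<open>wderiv_x_wave\<close> for \<open>w\<^sub>i\<^sub>+\<^sub>1\<close> (upwards from \<open>w\<^sub>-\<^sub>1, w\<^sub>0\<close>) and for \<open>w\<^sub>i\<^sub>-\<^sub>1\<close> (downwards
  from \<open>w\<^sub>0, w\<^sub>-\<^sub>1\<close>).\<close>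

definition opA :: "int \<Rightarrow> 'a dop" where
  "opA i = (if 0 \<le> i then dop_rec (\<lambda>n t. U t (int n) 0) 0 1 (nat (i + 1))
    else dop_rec (\<lambda>n t. U t (- 1 - int n) 0) 1 0 (nat (- i)))"

definition opB :: "int \<Rightarrow> 'a dop" where
  "opB i = (if 0 \<le> i then dop_rec (\<lambda>n t. - U t (int n) (- 1)) 1 0 (nat (i + 1))
    else dop_rec (\<lambda>n t. - U t (- 1 - int n) (- 1)) 0 1 (nat (- i)))"

lemma upoly_uminus_entry: "(\<lambda>t. - U t i j) \<in> upoly"
  by (rule eq_on[OF upoly_uminus[OF entry]]) simp

lemma coeff_1_upoly: "coeff 1 j \<in> upoly"
  by (simp add: coeff_1)

lemma dop_apply_1 [simp]: "dop_apply 1 w n t = w n t"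
  using dop_apply_const[of 1] by (simp add: one_pCons)

lemma wave_eq_ops:
  assumes "t \<in> S"
  shows "wave a i N t = dop_apply (opA i) (wave a 0) N t + dop_apply (opB i) (wave a (- 1)) N t"
proof (cases "0 \<le> i")
  case True
  \<comment> \<open>Position \<open>n\<close> holds the wave of index \<open>n - 1\<close>, so the
    start is at -1 and 0, and step \<open>n\<close> uses the equation for
    \<open>\<partial>\<^sub>x\<close> of the wave of index \<open>n\<close>.\<close>
  have "wave a (int n - 1) N t
      = dop_apply (dop_rec (\<lambda>n t. U t (int n) 0) 0 1 n) (wave a 0) N t
        + dop_apply (dop_rec (\<lambda>n t. - U t (int n) (- 1)) 1 0 n) (wave a (- 1)) N t" for n
    using assms
    by (intro dop_rec_apply[where v = "\<lambda>n. wave a (int n - 1)"])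
      (simp_all add: coeff_1_upoly entry upoly_uminus_entry upoly_wave wderiv_x_wave add.commute)
  from this[of "nat (i + 1)"] True show ?thesis
    by (simp add: opA_def opB_def)
next
  case False
  \<comment> \<open>Position \<open>n\<close> holds the wave of index \<open>- n\<close>, so step
    \<open>n\<close> uses the equation at index \<open>- 1 - n\<close>.\<close>
  have "wave a (- int n) N t
      = dop_apply (dop_rec (\<lambda>n t. U t (- 1 - int n) 0) 1 0 n) (wave a 0) N t
        + dop_apply (dop_rec (\<lambda>n t. - U t (- 1 - int n) (- 1)) 0 1 n) (wave a (- 1)) N t" for n
    using assms
    by (intro dop_rec_apply[where v = "\<lambda>n. wave a (- int n)"])
      (simp_all add: coeff_1_upoly entry upoly_uminus_entry upoly_wave wderiv_x_wave algebra_simps)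
  from this[of "nat (- i)"] False show ?thesis
    by (simp add: opA_def opB_def)
qed

section \<open>Orders and leading coefficients\<close>

definition ops :: "int \<Rightarrow> 'a dop set" where
  "ops m = {P. (\<forall>j. coeff P j \<in> upoly) \<and> (\<forall>j. int j > m \<longrightarrow> coeff P j = 0)}"

lemma ops_imp_dop_O: "P \<in> ops m \<Longrightarrow> P \<in> dop_O S m"
  by (auto simp: ops_def dop_O_def upoly_smooth)

lemma ops_mono: "P \<in> ops m \<Longrightarrow> m \<le> m' \<Longrightarrow> P \<in> ops m'"
  by (auto simp: ops_def)

lemma ops_0 [simp]: "0 \<in> ops m"
  by (auto simp: ops_def)

lemma ops_diff: "P \<in> ops m \<Longrightarrow> Q \<in> ops m \<Longrightarrow> P - Q \<in> ops m"
  by (auto simp: ops_def upoly_diff)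

lemma ops_add: "P \<in> ops m \<Longrightarrow> Q \<in> ops m \<Longrightarrow> P + Q \<in> ops m"
  by (auto simp: ops_def upoly.add)

lemma ops_smult: "f \<in> upoly \<Longrightarrow> P \<in> ops m \<Longrightarrow> smult f P \<in> ops m"
  by (auto simp: ops_def upoly.mult)

lemma ops_sum: "(\<And>x. x \<in> X \<Longrightarrow> P x \<in> ops m) \<Longrightarrow> (\<Sum>x\<in>X. P x) \<in> ops m"
  by (induction X rule: infinite_finite_induct) (auto intro: ops_add)

text \<open>The coefficient \<open>f\<close> may vanish, so \<open>n\<close> bounds the order
  without having to be the degree.\<close>

definition leading :: "'a dop \<Rightarrow> 'a tfun \<Rightarrow> nat \<Rightarrow> bool" where
  "leading P f n \<longleftrightarrow> P \<in> ops (int n) \<and> coeff P n = f"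

lemma leading_ops: "leading P f n \<Longrightarrow> P \<in> ops (int n)"
  by (simp add: leading_def)

lemma leading_diff:
  assumes "leading P f n"
  shows "P - monom f n \<in> ops (int n - 1)"
proof -
  have "coeff P j \<in> upoly" "coeff P n = f" "j > n \<Longrightarrow> coeff P j = 0" for j
    using assms by (auto simp: leading_def ops_def)
  moreover from this have "f \<in> upoly"
    by metis
  ultimately show ?thesis
    by (auto simp: ops_def upoly_diff)
qed

lemma leading_smult: "g \<in> upoly \<Longrightarrow> leading P f n \<Longrightarrow> leading (smult g P) (g * f) n"
  by (simp add: leading_def ops_smult)

text \<open>\<open>\<partial>\<^sub>x\<close> raises the order by one and keeps the top coefficient;
  \<open>Q\<close> and the order-0 term stay below order \<open>Suc n\<close>.\<close>

lemma leading_step: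
  assumes "leading P f n" "Q \<in> ops (int n)" "c \<in> upoly"
  shows "leading (dop_dx P - Q + [:c:]) f (Suc n)"
  using assms
  by (auto simp: leading_def ops_def coeff_dop_dx coeff_pCons split: nat.split
      intro!: upoly_diff upoly.add upoly_pderiv_x)

lemma dop_rec_01_leading:
  assumes "\<And>n. c n \<in> upoly"
  shows "leading (dop_rec c 0 1 (Suc n)) 1 n"
proof -
  \<comment> \<open>The order bound on the preceding operator, which \<open>leading_step\<close>
    requires, is carried along.\<close>
  have "leading (dop_rec c 0 1 (Suc n)) 1 n \<and> dop_rec c 0 1 n \<in> ops (int n)"
  proof (induction n)
    case 0
    then show ?case
      by (simp add: leading_def ops_def coeff_1_upoly) (simp add: coeff_1 fun_eq_iff)
  next
    case (Suc n)
    then have L: "leading (dop_rec c 0 1 (Suc n)) 1 n" and R: "dop_rec c 0 1 n \<in> ops (int n)"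
      by blast+
    show ?case
      using leading_step[OF L R assms, of n] ops_mono[OF leading_ops[OF L], of "int (Suc n)"]
      by (simp only: dop_rec.simps)
  qed
  then show ?thesis by simp
qed

text \<open>From the initial values 1 and 0 the first step yields the order-0 operator
  \<open>c 0 - 1\<close>, and later steps preserve this as top coefficient. This is the origin of
  the factors \<open>1 + u_{0,-1}\<close> and \<open>1 - u_{-1,0}\<close>.\<close>

lemma dop_rec_10_leading:
  assumes "\<And>n. c n \<in> upoly"
  shows "leading (dop_rec c 1 0 (Suc (Suc n))) (c 0 - 1) n"
proof -
  have "leading (dop_rec c 1 0 (Suc (Suc n))) (c 0 - 1) n \<and> dop_rec c 1 0 (Suc n) \<in> ops (int n)"
  proof (induction n)
    case 0
    then show ?case
      by (auto simp: leading_def ops_def coeff_1 coeff_pCons split: nat.split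
          intro: upoly_diff assms upoly.add upoly_uminus)
  next
    case (Suc n)
    then have L: "leading (dop_rec c 1 0 (Suc (Suc n))) (c 0 - 1) n" and R: "dop_rec c 1 0 (Suc n) \<in> ops (int n)"
      by blast+
    show ?case
      using leading_step[OF L R assms, of "Suc n"] ops_mono[OF leading_ops[OF L], of "int (Suc n)"]
      by (simp only: dop_rec.simps)
  qed
  then show ?thesis by simp
qed

lemma leading_opA_nonneg: "leading (opA (int n)) 1 n"
  using dop_rec_01_leading[of "\<lambda>n t. U t (int n) 0" n] by (simp add: opA_def entry nat_add_distrib)

lemma leading_opA_neg: "leading (opA (- 2 - int n)) (\<lambda>t. - (1 - U t (- 1) 0)) n"
  using dop_rec_10_leading[of "\<lambda>n t. U t (- 1 - int n) 0" n]
  by (simp add: opA_def entry nat_add_distrib fun_diff_def one_fun_def numeral_2_eq_2)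

lemma leading_opB_neg: "leading (opB (- 1 - int n)) 1 n"
  using dop_rec_01_leading[of "\<lambda>n t. - U t (- 1 - int n) (- 1)" n]
  by (simp add: opB_def upoly_uminus_entry nat_add_distrib)

lemma leading_opB_pos: "leading (opB (int n + 1)) (\<lambda>t. - (1 + U t 0 (- 1))) n"
proof -
  have "(\<lambda>t. - (1 + U t 0 (- 1))) = (\<lambda>t. - U t (int 0) (- 1)) - 1"
    by (simp add: fun_eq_iff)
  moreover have "opB (int n + 1) = dop_rec (\<lambda>n t. - U t (int n) (- 1)) 1 0 (Suc (Suc n))"
    by (simp add: opB_def nat_add_distrib del: dop_rec.simps)
  ultimately show ?thesis
    using dop_rec_10_leading[of "\<lambda>n t. - U t (int n) (- 1)" n] upoly_uminus_entry by simp
qed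

lemma opA_m1 [simp]: "opA (- 1) = 0" and opB_0 [simp]: "opB 0 = 0"
  by (simp_all add: opA_def opB_def)

lemma opA_ops_nonneg: "0 \<le> i \<Longrightarrow> opA i \<in> ops i"
  using leading_ops[OF leading_opA_nonneg[of "nat i"]] by simp

lemma opA_ops_neg: "i < 0 \<Longrightarrow> opA i \<in> ops (- 2 - i)"
  \<comment> \<open>At \<open>i = - 1\<close> the argument of \<open>nat\<close> is negative and the
    fact concerns another index; there the operator is 0.\<close>
  using leading_ops[OF leading_opA_neg[of "nat (- 2 - i)"]] by (cases "i = - 1") simp_all

lemma opB_ops_nonneg: "0 \<le> i \<Longrightarrow> opB i \<in> ops (i - 1)"
  using leading_ops[OF leading_opB_pos[of "nat (i - 1)"]] by (cases "i = 0") simp_all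

lemma opB_ops_neg: "i < 0 \<Longrightarrow> opB i \<in> ops (- 1 - i)"
  using leading_ops[OF leading_opB_neg[of "nat (- 1 - i)"]] by simp

section \<open>The operators generating the flows\<close>

definition flow_op :: "(int \<Rightarrow> 'a dop) \<Rightarrow> int \<Rightarrow> int \<Rightarrow> 'a dop" where
  "flow_op X k i = X (i + k)
    - (\<Sum>m\<in>flow_range k. smult (\<lambda>t. of_int (sgn k) * U t i (k - 1 - m)) (X m))"

lemma upoly_scaled_entry: "(\<lambda>t. c * U t i j) \<in> upoly"
  by (rule eq_on[OF mult[OF const entry]]) simp

text \<open>The operators do not involve \<open>a\<close>, hence the same ones serve both columns of
  \<open>Psi U\<close>.\<close>

lemma wderiv_wave_flow_op:
  assumes "k \<noteq> 0" "t \<in> S"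
  shows "wderiv k (wave a i) n t
    = dop_apply (flow_op opA k i) (wave a 0) n t + dop_apply (flow_op opB k i) (wave a (- 1)) n t"
  unfolding wderiv_wave[OF assms] wave_eq_ops[OF assms(2), of a "i + k"]
    flow_op_def dop_apply_diff dop_apply_sum dop_apply_smult
  by (subst wave_eq_ops[OF assms(2)])
    (simp add: sum_distrib_left sum.distrib algebra_simps)

lemma evolves_by_flow_op:
  assumes "k \<noteq> 0"
  shows "evolves_by S k (Psi U)
    (vector [vector [flow_op opA k 0, flow_op opB k 0],
      vector [flow_op opA k (- 1), flow_op opB k (- 1)]])"
  using assms
  by (simp add: evolves_by_def dop_mat_apply_def Psi_def forall_2 sum_2
      wave_u_eq wave_ubar_eq wderiv_wave_flow_op)

text \<open>For entries whose sum contributes only to the error term: the prescribed leading part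
  \<open>M\<close> must then come from \<open>X (i + k)\<close> alone.\<close>

lemma flow_op_diff_ops:
  assumes "X (i + k) - M \<in> ops r" "\<And>m. m \<in> flow_range k \<Longrightarrow> X m \<in> ops r"
  shows "flow_op X k i - M \<in> ops r"
proof -
  have "X (i + k) - M - (\<Sum>m\<in>flow_range k. smult (\<lambda>t. of_int (sgn k) * U t i (k - 1 - m)) (X m)) \<in> ops r"
    by (intro ops_diff ops_sum ops_smult assms upoly_scaled_entry)
  then show ?thesis
    by (simp add: flow_op_def algebra_simps)
qed

text \<open>Here \<open>X (i + k)\<close> also occurs in the sum, and its two occurrences combine.\<close>

lemma flow_op_diff_ops_combined:
  assumes "i + k \<in> flow_range k"
    and "smult (\<lambda>t. 1 - of_int (sgn k) * U t i (- 1 - i)) (X (i + k)) - M \<in> ops r"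
    and "\<And>m. m \<in> flow_range k - {i + k} \<Longrightarrow> X m \<in> ops r"
  shows "flow_op X k i - M \<in> ops r"
proof -
  define s where "s m = (\<lambda>t. of_int (sgn k) * U t i (k - 1 - m))" for m
  \<comment> \<open>At \<open>m = i + k\<close> the second index \<open>k - 1 - m\<close> is
    \<open>- 1 - i\<close>.\<close>
  have "(\<lambda>t. 1 - of_int (sgn k) * U t i (- 1 - i)) = 1 - s (i + k)"
    by (simp add: s_def fun_eq_iff)
  then have "X (i + k) - smult (s (i + k)) (X (i + k)) - M \<in> ops r"
    using assms(2) by (simp add: smult_diff_left)
  then have "X (i + k) - smult (s (i + k)) (X (i + k)) - M
      - (\<Sum>m\<in>flow_range k - {i + k}. smult (s m) (X m)) \<in> ops r"
    by (rule ops_diff) (auto simp: s_def intro!: ops_sum ops_smult assms(3) upoly_scaled_entry)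
  moreover have "flow_op X k i = X (i + k) - (smult (s (i + k)) (X (i + k))
      + (\<Sum>m\<in>flow_range k - {i + k}. smult (s m) (X m)))"
    unfolding flow_op_def s_def using assms(1) by (subst sum.remove[of _ "i + k"]) simp_all
  ultimately show ?thesis
    by (simp only: diff_diff_eq add_ac)
qed

lemma positive_flow_shapes:
  fixes n :: nat
  defines "k \<equiv> int (Suc n)"
  shows "flow_op opA k 0 - monom 1 (Suc n) \<in> ops (k - 1)"
    and "flow_op opB k 0 - monom (\<lambda>t. - (1 + U t 0 (- 1))) n \<in> ops (k - 2)"
    and "flow_op opA k (- 1) - monom (\<lambda>t. 1 - U t (- 1) 0) n \<in> ops (k - 2)"
    and "flow_op opB k (- 1) \<in> ops (k - 2)"
proof -
  have k: "0 < k"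
    by (simp add: k_def)
  have range: "m \<in> flow_range k \<longleftrightarrow> 0 \<le> m \<and> m < k" for m
    by (auto simp: flow_range_def k_def)
  show "flow_op opA k 0 - monom 1 (Suc n) \<in> ops (k - 1)"
  proof (rule flow_op_diff_ops)
    show "opA (0 + k) - monom 1 (Suc n) \<in> ops (k - 1)"
      using leading_diff[OF leading_opA_nonneg[of "Suc n"]] by (simp add: k_def)
  qed (use k in \<open>auto simp: range intro: ops_mono[OF opA_ops_nonneg]\<close>)
  show "flow_op opB k 0 - monom (\<lambda>t. - (1 + U t 0 (- 1))) n \<in> ops (k - 2)"
  proof (rule flow_op_diff_ops)
    show "opB (0 + k) - monom (\<lambda>t. - (1 + U t 0 (- 1))) n \<in> ops (k - 2)"
      using leading_diff[OF leading_opB_pos[of n]] by (simp add: k_def add.commute)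
  qed (use k in \<open>auto simp: range intro: ops_mono[OF opB_ops_nonneg]\<close>)
  \<comment> \<open>The index \<open>i + k = k - 1\<close> lies in the range and is the only one
    there whose \<open>opA\<close> can reach order \<open>k - 1\<close>; its two occurrences combine
    to the factor \<open>1 - u_{-1,0}\<close>.\<close>
  show "flow_op opA k (- 1) - monom (\<lambda>t. 1 - U t (- 1) 0) n \<in> ops (k - 2)"
  proof (rule flow_op_diff_ops_combined)
    let ?g = "\<lambda>t. 1 - U t (- 1) 0"
    have "?g \<in> upoly"
      by (rule eq_on[OF upoly_diff[OF upoly_1 entry]]) simp
    then have "smult ?g (opA (int n)) - monom ?g n \<in> ops (int n - 1)"
      using leading_diff[OF leading_smult[OF _ leading_opA_nonneg]] by simp
    then show "smult (\<lambda>t. 1 - of_int (sgn k) * U t (- 1) (- 1 - - 1)) (opA (- 1 + k)) - monom ?g n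
        \<in> ops (k - 2)"
      by (simp add: k_def)
  qed (use k in \<open>auto simp: range intro: ops_mono[OF opA_ops_nonneg]\<close>)
  have "flow_op opB k (- 1) - 0 \<in> ops (k - 2)"
    by (rule flow_op_diff_ops) (use k in \<open>auto simp: range intro: ops_mono[OF opB_ops_nonneg]\<close>)
  then show "flow_op opB k (- 1) \<in> ops (k - 2)"
    by simp
qed

text \<open>Mirror image of the positive case, with the two basic waves, and thus \<open>opA\<close>
  and \<open>opB\<close>, exchanged. The combined term is now \<open>opB (- k)\<close> in row 0,
  where \<open>sgn (- k) = - 1\<close> produces the plus sign in
  \<open>1 + u_{0,-1}\<close>.\<close>

lemma negative_flow_shapes:
  fixes n :: nat
  defines "k \<equiv> int (Suc n)"
  shows "flow_op opA (- k) 0 \<in> ops (k - 2)"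
    and "flow_op opB (- k) 0 - monom (\<lambda>t. 1 + U t 0 (- 1)) n \<in> ops (k - 2)"
    and "flow_op opA (- k) (- 1) - monom (\<lambda>t. - (1 - U t (- 1) 0)) n \<in> ops (k - 2)"
    and "flow_op opB (- k) (- 1) - monom 1 (Suc n) \<in> ops (k - 1)"
proof -
  have k: "0 < k"
    by (simp add: k_def)
  have range: "m \<in> flow_range (- k) \<longleftrightarrow> - k \<le> m \<and> m < 0" for m
    by (auto simp: flow_range_def k_def)
  have "flow_op opA (- k) 0 - 0 \<in> ops (k - 2)"
    by (rule flow_op_diff_ops) (use k in \<open>auto simp: range intro: ops_mono[OF opA_ops_neg]\<close>)
  then show "flow_op opA (- k) 0 \<in> ops (k - 2)"
    by simp
  show "flow_op opB (- k) 0 - monom (\<lambda>t. 1 + U t 0 (- 1)) n \<in> ops (k - 2)"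
  proof (rule flow_op_diff_ops_combined)
    let ?g = "\<lambda>t. 1 + U t 0 (- 1)"
    have "?g \<in> upoly"
      by (rule eq_on[OF add[OF upoly_1 entry]]) simp
    then have "smult ?g (opB (- 1 - int n)) - monom ?g n \<in> ops (int n - 1)"
      using leading_diff[OF leading_smult[OF _ leading_opB_neg]] by simp
    then show "smult (\<lambda>t. 1 - of_int (sgn (- k)) * U t 0 (- 1 - 0)) (opB (0 + - k)) - monom ?g n
        \<in> ops (k - 2)"
      by (simp add: k_def)
  qed (use k in \<open>auto simp: range intro: ops_mono[OF opB_ops_neg]\<close>)
  show "flow_op opA (- k) (- 1) - monom (\<lambda>t. - (1 - U t (- 1) 0)) n \<in> ops (k - 2)"
  proof (rule flow_op_diff_ops)
    show "opA (- 1 + - k) - monom (\<lambda>t. - (1 - U t (- 1) 0)) n \<in> ops (k - 2)"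
      using leading_diff[OF leading_opA_neg[of n]] by (simp add: k_def)
  qed (use k in \<open>auto simp: range intro: ops_mono[OF opA_ops_neg]\<close>)
  show "flow_op opB (- k) (- 1) - monom 1 (Suc n) \<in> ops (k - 1)"
  proof (rule flow_op_diff_ops)
    show "opB (- 1 + - k) - monom 1 (Suc n) \<in> ops (k - 1)"
      using leading_diff[OF leading_opB_neg[of "Suc n"]] by (simp add: k_def)
  qed (use k in \<open>auto simp: range intro: ops_mono[OF opB_ops_neg]\<close>)
qed

end

theorem proposition7:
  fixes U :: "(int \<Rightarrow> 'a::real_normed_field) \<Rightarrow> int \<Rightarrow> int \<Rightarrow> 'a"
    and S :: "(int \<Rightarrow> 'a) set"
    and k :: nat
  assumes "time_domain S"
    and "satisfies_flows S U"
    and "k \<ge> 1"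
  shows
    "(\<exists>A B C D.
        evolves_by S (int k) (Psi U) (vector [vector [A, B], vector [C, D]]) \<and>
        A - monom 1 k \<in> dop_O S (int k - 1) \<and>
        B - monom (\<lambda>t. - (1 + U t 0 (- 1))) (k - 1) \<in> dop_O S (int k - 2) \<and>
        C - monom (\<lambda>t. 1 - U t (- 1) 0) (k - 1) \<in> dop_O S (int k - 2) \<and>
        D \<in> dop_O S (int k - 2)) \<and>
     (\<exists>A B C D.
        evolves_by S (- int k) (Psi U) (vector [vector [A, B], vector [C, D]]) \<and>
        A \<in> dop_O S (int k - 2) \<and>
        B - monom (\<lambda>t. 1 + U t 0 (- 1)) (k - 1) \<in> dop_O S (int k - 2) \<and>
        C - monom (\<lambda>t. - (1 - U t (- 1) 0)) (k - 1) \<in> dop_O S (int k - 2) \<and>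
        D - monom 1 k \<in> dop_O S (int k - 1))"
proof -
  interpret flow_solution S U
    using assms by unfold_locales
  \<comment> \<open>Replaces the truncated subtraction \<open>k - 1\<close> in the leading orders by
    \<open>n\<close>.\<close>
  obtain n where k: "k = Suc n"
    using assms(3) by (cases k) auto
  have "evolves_by S (int k) (Psi U)
      (vector [vector [flow_op opA (int k) 0, flow_op opB (int k) 0],
        vector [flow_op opA (int k) (- 1), flow_op opB (int k) (- 1)]])"
    and "evolves_by S (- int k) (Psi U)
      (vector [vector [flow_op opA (- int k) 0, flow_op opB (- int k) 0],
        vector [flow_op opA (- int k) (- 1), flow_op opB (- int k) (- 1)]])"
    using assms(3) by (auto intro!: evolves_by_flow_op)
  moreover note positive_flow_shapes[of n, THEN ops_imp_dop_O]
    negative_flow_shapes[of n, THEN ops_imp_dop_O]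
  ultimately show ?thesis
    unfolding k diff_Suc_1 by blast
qed

end
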